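(* Let $\hat x\in\mathbb{R}^n$, let $\boldsymbol{\xi}$ be an $m$-dimensional random vector and let $g:\mathbb{R}^m\times\mathbb{R}^n\to\mathbb{R}$ be a function. Suppose that: (a) $\boldsymbol{\xi}$ has a finite distribution with outcomes $\xi^1,\dots,\xi^\nu$ and corresponding positive probabilities $p_1,\dots,p_\nu$. (b) For all $i=1,\dots,\nu$, the function $g(\xi^i,\cdot\,)$ is smooth (continuously differentiable) in a neighborhood of $\hat x$. (c) $\mathbb{E}[g(\boldsymbol{\xi},\hat x)]<0$ and $g(\xi^i,\hat x)>0$ for some $i$. Let $\bar p(x)$ denote the buffered failure probability of $g(\boldsymbol{\xi},x)$, let $\partial\bar p(\hat x)$ be the set of general (limiting/Mordukhovich) subgradients of $\bar p$ at $\hat x$, and let $\Gamma(\hat x)=\operatorname{argmin}_{\gamma\ge 0}\mathbb{E}\big[\max\{0,\gamma g(\boldsymbol{\xi},\hat x)+1\}\big]$. If $y\in\partial\bar p(\hat x)$, then there are $\hat\gamma\in\Gamma(\hat x)$ and multipliers $\mu_i\in[0,1]$, $i=1,\dots,\nu$, such that $$y=\hat\gamma\sum_{i=1}^\nu p_i\mu_i\nabla_x g(\xi^i,\hat x),$$ and the multipliers satisfy $$\sum_{i=1}^\nu p_i\mu_i g(\xi^i,\hat x)=0$$ and, for all $i$, $$\mu_i\in\begin{cases}\{0\} & \text{if } \hat\gamma g(\xi^i,\hat x)+1<0\\ [0,1] & \text{if } \hat\gamma g(\xi^i,\hat x)+1=0\\ \{1\} & \text{if } \hat\gamma g(\xi^i,\hat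 x)+1>0.\end{cases}$$
   Context: Buffered failure probability. For $x\in\mathbb{R}^n$ such that $g(\boldsymbol{\xi},x)$ is an integrable random variable, let $p(x)=\mathrm{prob}\{g(\boldsymbol{\xi},x)>0\}$ be the (conventional) failure probability. The buffered failure probability is $$\bar p(x)=\begin{cases}0 & \text{if } p(x)=0\\ 1-\bar\alpha & \text{if } p(x)>0 \text{ and } \mathbb{E}[g(\boldsymbol{\xi},x)]<0\\ 1 & \text{otherwise,}\end{cases}$$ where $\bar\alpha\in[0,1]$ (depending on $x$) is the probability level $\alpha$ that makes the $\alpha$-superquantile $\bar q_\alpha(x)$ of $g(\boldsymbol{\xi},x)$ equal to zero. The superquantile is $$\bar q_\alpha(x)=q_\alpha(x)+\frac{1}{1-\alpha}\mathbb{E}\big[\max\{0,g(\boldsymbol{\xi},x)-q_\alpha(x)\}\big]\quad\text{for }\alpha\in(0,1),$$ where $q_\alpha(x)=\min\{z\in\mathbb{R} : \mathrm{prob}\{g(\boldsymbol{\xi},x)\le z\}\ge\alpha\}$ is the $\alpha$-quantile of $g(\boldsymbol{\xi},x)$, with $\bar q_0(x)=\mathbb{E}[g(\boldsymbol{\xi},x)]$ and $\bar q_1(x)=\lim_{\alpha\nearrow 1}\bar q_\alpha(x)$. Known formula (Norton and Uryasev; Mafusalov and Uryasev): whenever $p(x)>0$, one has $\bar p(x)=\min_{\gamma\ge 0}\mathbb{E}\big[\max\{0,\gamma g(\boldsymbol{\xi},x)+1\}\big]$. Subgradients. For $f:\mathbb{R}^n\to[-\infty,\infty]$ finite at $x$,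 a vector $v$ is a regular subgradient of $f$ at $x$ if $f(x')\ge f(x)+\langle v,x'-x\rangle+o(\|x'-x\|_2)$ as $x'\to x$. A vector $v$ is a (general, limiting or Mordukhovich) subgradient of $f$ at $x$, written $v\in\partial f(x)$, if there are $x^k\to x$ with $f(x^k)\to f(x)$ and regular subgradients $v^k$ of $f$ at $x^k$ with $v^k\to v$. *)

theory Defs
  imports "HOL-Probability.Probability" "HOL-Library.Landau_Symbols"
begin

section \<open>Buffered failure probability of a real random variable\<close>

definition failure_prob :: "'w measure \<Rightarrow> ('w \<Rightarrow> real) \<Rightarrow> real" where
  "failure_prob M Z = measure M {\<omega> \<in> space M. Z \<omega> > 0}"

text \<open>The minimum is attained for levels strictly between 0 and 1,
  the only ones at which the quantile is used.\<close>

definition quantile :: "'w measure \<Rightarrow> ('w \<Rightarrow> real) \<Rightarrow> real \<Rightarrow> real" where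
  "quantile M Z \<alpha> = (LEAST z. measure M {\<omega> \<in> space M. Z \<omega> \<le> z} \<ge> \<alpha>)"

definition open_superquantile :: "'w measure \<Rightarrow> ('w \<Rightarrow> real) \<Rightarrow> real \<Rightarrow> real" where
  "open_superquantile M Z \<alpha> =
     quantile M Z \<alpha> + 1 / (1 - \<alpha>) * (\<integral>\<omega>. max 0 (Z \<omega> - quantile M Z \<alpha>) \<partial>M)"

text \<open>The values are extended reals because the limit at level 1 is infinite for random variables
  that are unbounded above. Levels outside the interval from 0 to 1 are meaningless.\<close>

definition superquantile :: "'w measure \<Rightarrow> ('w \<Rightarrow> real) \<Rightarrow> real \<Rightarrow> ereal" where
  "superquantile M Z \<alpha> =
     (if \<alpha> = 0 then ereal (\<integral>\<omega>. Z \<omega> \<partial>M)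
      else if \<alpha> = 1 then Lim (at_left 1) (\<lambda>\<beta>. ereal (open_superquantile M Z \<beta>))
      else ereal (open_superquantile M Z \<alpha>))"

text \<open>In the middle case the level is unique: the superquantile is strictly increasing in the level
  until it reaches the essential supremum, which is positive here.\<close>

definition buffered_failure_prob :: "'w measure \<Rightarrow> ('w \<Rightarrow> real) \<Rightarrow> real" where
  "buffered_failure_prob M Z =
     (if failure_prob M Z = 0 then 0
      else if (\<integral>\<omega>. Z \<omega> \<partial>M) < 0
        then 1 - (THE \<alpha>. \<alpha> \<in> {0..1} \<and> superquantile M Z \<alpha> = 0)
      else 1)"

section \<open>Gradients and subgradients\<close>

definition grad :: "('a::real_inner \<Rightarrow> real) \<Rightarrow> 'a \<Rightarrow> 'a" where
  "grad f x = (THE D. GDERIV f x :> D)"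

definition smooth_near :: "('a::real_inner \<Rightarrow> real) \<Rightarrow> 'a \<Rightarrow> bool" where
  "smooth_near f x \<longleftrightarrow>
     (\<exists>U. open U \<and> x \<in> U \<and> (\<forall>u\<in>U. GDERIV f u :> grad f u) \<and> continuous_on U (grad f))"

definition regular_subgradient :: "('a::real_inner \<Rightarrow> ereal) \<Rightarrow> 'a \<Rightarrow> 'a \<Rightarrow> bool" where
  "regular_subgradient f x v \<longleftrightarrow>
     \<bar>f x\<bar> \<noteq> \<infinity> \<and>
     (\<exists>r \<in> o[at x](\<lambda>x'. norm (x' - x)).
        \<forall>\<^sub>F x' in at x. f x' \<ge> f x + ereal (v \<bullet> (x' - x)) + ereal (r x'))"

definition subgradients :: "('a::real_inner \<Rightarrow> ereal) \<Rightarrow> 'a \<Rightarrow> 'a set" where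
  "subgradients f x =
     {v. \<bar>f x\<bar> \<noteq> \<infinity> \<and>
         (\<exists>X V. X \<longlonglongrightarrow> x \<and> (\<lambda>k. f (X k)) \<longlonglongrightarrow> f x \<and>
                (\<forall>k::nat. regular_subgradient f (X k) (V k)) \<and> V \<longlonglongrightarrow> v)}"

end

theory Submission
  imports Defs
begin

text \<open>Let \<open>\<phi> x \<gamma>\<close> be the mean of \<open>max 0 (\<gamma> * g(\<xi>, x) + 1)\<close>. Where the mean of \<open>g(\<xi>, x)\<close> is negative and
  failure has positive probability, the buffered failure probability is the minimum of \<open>\<phi> x\<close> over
  \<open>\<gamma> \<ge> 0\<close>, attained at some \<open>\<gamma> > 0\<close> (\<open>buffered_failure_prob_eq_hinge_mean\<close>). This is duality: the
  quantile minimizes \<open>c + E[max 0 (Z - c)] / (1 - \<alpha>)\<close> over \<open>c\<close>, so the level at which this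
  minimum vanishes is read off after substituting \<open>c = -1/\<gamma>\<close>. The formula holds for every integrable
  random variable. Both sign conditions persist near the reference point, because with finitely
  many outcomes the mean is a finite sum of continuous functions.

  The buffered failure probability is therefore locally a marginal function, and a regular subgradient
  \<open>v\<close> of it at \<open>x\<close> makes \<open>(0, v)\<close> a regular subgradient of \<open>(\<gamma>, x) \<mapsto> \<phi> x \<gamma>\<close> at a minimizer. The
  latter function is a finite sum of hinges of smooth functions, so its one-sided directional
  derivative is the support function of a zonotope. Separation puts \<open>(0, v)\<close> into the zonotope
  (\<open>zonotope_support_function\<close>), and the coefficients are the multipliers: the component of \<open>\<gamma>\<close> gives
  the equation with right-hand side zero, that of \<open>x\<close> the formula for the subgradient
  (\<open>regular_subgradient_hinge_multipliers\<close>).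

  A limiting subgradient is a limit of regular ones. Minimizers and multipliers at the nearby points
  are bounded, and all conditions on them are closed, so a convergent subsequence yields the claim
  (\<open>subgradient_hinge_multipliers\<close>).\<close>

section \<open>Quantiles and the variational form of the superquantile\<close>

definition mean_excess :: "'w measure \<Rightarrow> ('w \<Rightarrow> real) \<Rightarrow> real \<Rightarrow> real" where
  "mean_excess M Z c = (\<integral>\<omega>. max 0 (Z \<omega> - c) \<partial>M)"

definition hinge_mean :: "'w measure \<Rightarrow> ('w \<Rightarrow> real) \<Rightarrow> real \<Rightarrow> real" where
  "hinge_mean M Z \<gamma> = (\<integral>\<omega>. max 0 (\<gamma> * Z \<omega> + 1) \<partial>M)"

context prob_space
begin

text \<open>The points where the distribution function is at least \<open>\<alpha>\<close> form an up-set; right continuity puts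
  its infimum into it, the limits at both infinities make the infimum finite, and the limit from the
  left bounds the probability strictly below it.\<close>

lemma
  assumes [measurable]: "Z \<in> borel_measurable M" and "0 < \<alpha>" "\<alpha> < 1"
  shows prob_le_quantile: "\<alpha> \<le> prob {\<omega> \<in> space M. Z \<omega> \<le> quantile M Z \<alpha>}" (is ?A)
    and prob_less_quantile: "prob {\<omega> \<in> space M. Z \<omega> < quantile M Z \<alpha>} \<le> \<alpha>" (is ?B)
proof -
  interpret D: real_distribution "distr M borel Z"
    by simp
  let ?F = "cdf (distr M borel Z)"
  have F: "prob {\<omega> \<in> space M. Z \<omega> \<le> z} = ?F z" for z
    unfolding cdf_def by (subst measure_distr) (auto intro!: arg_cong[where f = prob])
  define S where "S = {z. \<alpha> \<le> ?F z}"
  have "eventually (\<lambda>z. ?F z > \<alpha>) at_top"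
    using order_tendstoD(1)[OF D.cdf_lim_at_top_prob] assms by simp
  then have S_ne: "S \<noteq> {}"
    unfolding S_def eventually_at_top_linorder by (metis empty_iff less_eq_real_def mem_Collect_eq order_refl)
  have "eventually (\<lambda>z. ?F z < \<alpha>) at_bot"
    using order_tendstoD(2)[OF D.cdf_lim_at_bot] assms by simp
  then obtain b where b: "\<And>z. z \<le> b \<Longrightarrow> ?F z < \<alpha>"
    unfolding eventually_at_bot_linorder by blast
  then have S_bdd: "bdd_below S"
    unfolding S_def by (intro bdd_belowI[of _ b]) (metis linorder_not_less mem_Collect_eq nle_le)
  have up: "z \<in> S" if "Inf S < z" for z
  proof -
    have "\<exists>s\<in>S. s < z"
      using that unfolding cInf_less_iff[OF S_ne S_bdd] .
    then obtain s where "s \<in> S" "s < z"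
      by blast
    then show ?thesis
      using D.cdf_nondecreasing[of s z] by (auto simp: S_def)
  qed
  have "(?F \<longlongrightarrow> ?F (Inf S)) (at_right (Inf S))"
    using D.cdf_is_right_cont unfolding continuous_within .
  then have Inf_in: "\<alpha> \<le> ?F (Inf S)"
  proof (rule tendsto_lowerbound)
    show "\<forall>\<^sub>F z in at_right (Inf S). \<alpha> \<le> ?F z"
      using up by (auto simp: S_def eventually_at_filter intro!: always_eventually)
  qed auto
  have q: "quantile M Z \<alpha> = Inf S"
    unfolding quantile_def F using Inf_in S_bdd
    by (intro Least_equality) (auto simp: S_def intro: cInf_lower)
  show ?A
    unfolding F q by (rule Inf_in)
  have "(?F \<longlongrightarrow> measure (distr M borel Z) {..<Inf S}) (at_left (Inf S))"
    by (rule D.cdf_at_left)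
  then have "measure (distr M borel Z) {..<Inf S} \<le> \<alpha>"
  proof (rule tendsto_upperbound)
    show "\<forall>\<^sub>F z in at_left (Inf S). ?F z \<le> \<alpha>"
      unfolding eventually_at_filter
    proof (intro always_eventually allI impI)
      fix z assume "z \<in> {..<Inf S}"
      then have "z \<notin> S" using cInf_lower[OF _ S_bdd, of z] by auto
      then show "?F z \<le> \<alpha>" by (simp add: S_def)
    qed
  qed auto
  also have "measure (distr M borel Z) {..<Inf S} = prob {\<omega> \<in> space M. Z \<omega> < Inf S}"
    by (subst measure_distr) (auto intro!: arg_cong[where f = prob])
  finally show ?B unfolding q .
qed

lemma integrable_excess [simp]: "integrable M Z \<Longrightarrow> integrable M (\<lambda>\<omega>. max 0 (Z \<omega> - c))"
  for Z :: "_ \<Rightarrow> real"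
  by (intro Bochner_Integration.integrable_max integrable_diff) auto

lemma integrable_hinge [simp]: "integrable M Z \<Longrightarrow> integrable M (\<lambda>\<omega>. max 0 (\<gamma> * Z \<omega> + 1))"
  for Z :: "_ \<Rightarrow> real"
  by (intro Bochner_Integration.integrable_max Bochner_Integration.integrable_add) auto

lemma mean_excess_nonneg: "0 \<le> mean_excess M Z c"
  unfolding mean_excess_def by (rule Bochner_Integration.integral_nonneg) auto

lemma mean_excess_antimono: "integrable M Z \<Longrightarrow> c \<le> d \<Longrightarrow> mean_excess M Z d \<le> mean_excess M Z c"
  unfolding mean_excess_def by (intro integral_mono) auto

text \<open>The mean excess is convex with one-sided slopes \<open>-P(Z > q)\<close> and \<open>-P(Z \<ge> q)\<close> at \<open>q\<close>; at an
  \<open>\<alpha>\<close>-quantile the number \<open>-(1 - \<alpha>)\<close> lies between the two, so that it is a subgradient there.\<close>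

lemma mean_excess_quantile_subgradient:
  assumes Z: "integrable M Z" and \<alpha>: "0 < \<alpha>" "\<alpha> < 1"
  defines "q \<equiv> quantile M Z \<alpha>"
  shows "mean_excess M Z q - (1 - \<alpha>) * (c - q) \<le> mean_excess M Z c"
proof -
  have [measurable]: "Z \<in> borel_measurable M"
    using Z by auto
  let ?R = "{\<omega> \<in> space M. q < Z \<omega>}" and ?L = "{\<omega> \<in> space M. q \<le> Z \<omega>}"
  have R: "prob ?R \<le> 1 - \<alpha>"
    using prob_le_quantile[of Z \<alpha>] \<alpha> prob_neg[of "\<lambda>\<omega>. Z \<omega> \<le> q"] by (simp add: q_def not_le)
  have L: "1 - \<alpha> \<le> prob ?L"
    using prob_less_quantile[of Z \<alpha>] \<alpha> prob_neg[of "\<lambda>\<omega>. Z \<omega> < q"] by (simp add: q_def not_less)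
  have supp: "mean_excess M Z q - (c - q) * prob A \<le> mean_excess M Z c"
    if [measurable]: "A \<in> sets M"
      and le: "\<And>\<omega>. \<omega> \<in> space M \<Longrightarrow> max 0 (Z \<omega> - q) - (c - q) * indicator A \<omega> \<le> max 0 (Z \<omega> - c)" for A
  proof -
    have I: "integrable M (\<lambda>\<omega>. (c - q) * indicator A \<omega>)"
      by (intro integrable_mult_right) (simp add: emeasure_eq_measure)
    have "mean_excess M Z q - (c - q) * prob A
        = (\<integral>\<omega>. max 0 (Z \<omega> - q) - (c - q) * indicator A \<omega> \<partial>M)"
      unfolding mean_excess_def using Z I
      by (subst Bochner_Integration.integral_diff) (auto simp: sets.Int_space_eq2)
    also have "\<dots> \<le> mean_excess M Z c"
      unfolding mean_excess_def using Z I le by (intro integral_mono) auto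
    finally show ?thesis .
  qed
  show ?thesis
  proof (cases "q \<le> c")
    case True
    have "(c - q) * prob ?R \<le> (c - q) * (1 - \<alpha>)"
      using True R by (intro mult_left_mono) auto
    moreover have "mean_excess M Z q - (c - q) * prob ?R \<le> mean_excess M Z c"
    proof (rule supp)
      show "?R \<in> sets M" by measurable
      show "max 0 (Z \<omega> - q) - (c - q) * indicator ?R \<omega> \<le> max 0 (Z \<omega> - c)"
        if "\<omega> \<in> space M" for \<omega>
        using that True by (cases "\<omega> \<in> ?R") auto
    qed
    ultimately show ?thesis by (simp add: mult.commute)
  next
    case False
    have "(c - q) * prob ?L \<le> (c - q) * (1 - \<alpha>)"
      using False L by (intro mult_left_mono_neg) auto
    moreover have "mean_excess M Z q - (c - q) * prob ?L \<le> mean_excess M Z c"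
    proof (rule supp)
      show "?L \<in> sets M" by measurable
      show "max 0 (Z \<omega> - q) - (c - q) * indicator ?L \<omega> \<le> max 0 (Z \<omega> - c)"
        if "\<omega> \<in> space M" for \<omega>
        using that False by (cases "\<omega> \<in> ?L") auto
    qed
    ultimately show ?thesis by (simp add: mult.commute)
  qed
qed

text \<open>Together with the definition, this says that the quantile minimizes the right-hand side in \<open>c\<close>, the
  variational formula of Rockafellar and Uryasev.\<close>

lemma open_superquantile_le:
  assumes "integrable M Z" "0 < \<alpha>" "\<alpha> < 1"
  shows "open_superquantile M Z \<alpha> \<le> c + mean_excess M Z c / (1 - \<alpha>)"
proof -
  let ?q = "quantile M Z \<alpha>"
  have "?q + mean_excess M Z ?q / (1 - \<alpha>) \<le> ?q + (mean_excess M Z c + (1 - \<alpha>) * (c - ?q)) / (1 - \<alpha>)"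
    using mean_excess_quantile_subgradient[OF assms, of c] assms(2,3)
    by (intro add_left_mono divide_right_mono) auto
  also have "\<dots> = c + mean_excess M Z c / (1 - \<alpha>)"
    using assms(3) by (simp add: add_divide_distrib)
  finally show ?thesis
    by (simp add: open_superquantile_def mean_excess_def)
qed

lemma open_superquantile_mono:
  assumes Z: "integrable M Z" and "0 < \<alpha>" "\<alpha> \<le> \<beta>" "\<beta> < 1"
  shows "open_superquantile M Z \<alpha> \<le> open_superquantile M Z \<beta>"
proof -
  let ?q = "quantile M Z \<beta>"
  have "open_superquantile M Z \<alpha> \<le> ?q + mean_excess M Z ?q / (1 - \<alpha>)"
    using assms by (intro open_superquantile_le) auto
  also have "\<dots> \<le> ?q + mean_excess M Z ?q / (1 - \<beta>)"
    using assms mean_excess_nonneg[of Z ?q] by (intro add_left_mono divide_left_mono) auto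
  finally show ?thesis
    by (simp add: open_superquantile_def mean_excess_def)
qed

text \<open>Since the superquantile increases with the level, the limit at level one exists in the
  extended reals and dominates all earlier values.\<close>

lemma open_superquantile_le_superquantile_1:
  assumes Z: "integrable M Z" and "0 < \<alpha>" "\<alpha> < 1"
  shows "ereal (open_superquantile M Z \<alpha>) \<le> superquantile M Z 1"
proof -
  let ?s = "\<lambda>\<beta>. ereal (open_superquantile M Z \<beta>)"
  define l where "l = (SUP \<beta>\<in>{0<..<1}. ?s \<beta>)"
  have le: "?s \<beta> \<le> l" if "0 < \<beta>" "\<beta> < 1" for \<beta>
    unfolding l_def using that by (intro SUP_upper) auto
  have "(?s \<longlongrightarrow> l) (at_left 1)"
  proof (rule increasing_tendsto)
    show "\<forall>\<^sub>F \<beta> in at_left 1. ?s \<beta> \<le> l"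
      using eventually_at_left_real[OF zero_less_one] by eventually_elim (auto intro: le)
    fix x assume "x < l"
    then obtain \<beta>0 where \<beta>0: "0 < \<beta>0" "\<beta>0 < 1" "x < ?s \<beta>0"
      unfolding l_def less_SUP_iff by auto
    have "\<forall>\<^sub>F \<beta> in at_left 1. \<beta> \<in> {\<beta>0<..<1}"
      using \<beta>0 by (intro eventually_at_left_real)
    then show "\<forall>\<^sub>F \<beta> in at_left 1. x < ?s \<beta>"
    proof eventually_elim
      case (elim \<beta>)
      with \<beta>0 have "?s \<beta>0 \<le> ?s \<beta>" using Z by (auto intro!: open_superquantile_mono)
      with \<beta>0(3) show ?case by (rule less_le_trans)
    qed
  qed
  then have "superquantile M Z 1 = l"
    by (simp add: superquantile_def tendsto_Lim)
  with le[of \<alpha>] assms show ?thesis by simp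
qed

section \<open>The buffered failure probability as a minimum\<close>

lemma mean_excess_pos:
  assumes Z: "integrable M Z" and "failure_prob M Z \<noteq> 0" and "c \<le> 0"
  shows "0 < mean_excess M Z c"
proof -
  have [measurable]: "Z \<in> borel_measurable M"
    using Z by auto
  have "mean_excess M Z 0 \<noteq> 0"
  proof
    assume "mean_excess M Z 0 = 0"
    then have "AE \<omega> in M. max 0 (Z \<omega>) = 0"
      using Z integral_nonneg_eq_0_iff_AE[of M "\<lambda>\<omega>. max 0 (Z \<omega> - 0)"]
        integrable_excess[of Z 0] by (simp add: mean_excess_def)
    then have "AE \<omega> in M. \<not> 0 < Z \<omega>"
      by eventually_elim auto
    then have "failure_prob M Z = 0"
      unfolding failure_prob_def by (intro prob_eq_0[THEN iffD2]) auto
    with assms show False by simp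
  qed
  with mean_excess_nonneg[of Z 0] mean_excess_antimono[OF Z \<open>c \<le> 0\<close>] show ?thesis by simp
qed

text \<open>The substitution \<open>c = -1/\<gamma>\<close> links the two minimization problems.\<close>

lemma hinge_mean_eq_mean_excess:
  assumes "0 < \<gamma>"
  shows "hinge_mean M Z \<gamma> = \<gamma> * mean_excess M Z (- 1 / \<gamma>)"
proof -
  have "max 0 (\<gamma> * z + 1) = \<gamma> * max 0 (z - (- 1 / \<gamma>))" for z
    using assms by (simp add: max_def field_simps)
  then show ?thesis
    by (simp add: hinge_mean_def mean_excess_def)
qed

lemma hinge_mean_0: "hinge_mean M Z 0 = 1"
  by (simp add: hinge_mean_def prob_space)

lemma hinge_mean_lower:
  assumes Z: "integrable M Z" and "0 \<le> \<gamma>"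
  shows "\<gamma> * mean_excess M Z 0 \<le> hinge_mean M Z \<gamma>"
proof -
  have "\<gamma> * mean_excess M Z 0 = (\<integral>\<omega>. \<gamma> * max 0 (Z \<omega>) \<partial>M)"
    by (simp add: mean_excess_def)
  also have "\<dots> \<le> hinge_mean M Z \<gamma>"
    unfolding hinge_mean_def
  proof (intro integral_mono)
    show "\<gamma> * max 0 (Z \<omega>) \<le> max 0 (\<gamma> * Z \<omega> + 1)" for \<omega>
      using \<open>0 \<le> \<gamma>\<close> by (cases "0 \<le> Z \<omega>") auto
  qed (use Z integrable_excess[OF Z, of 0] in auto)
  finally show ?thesis .
qed

lemma continuous_on_hinge_mean:
  assumes Z: "integrable M Z"
  shows "continuous_on A (hinge_mean M Z)"
proof -
  have "norm (hinge_mean M Z \<gamma> - hinge_mean M Z \<delta>) \<le> (\<integral>\<omega>. \<bar>Z \<omega>\<bar> \<partial>M) * norm (\<gamma> - \<delta>)" for \<gamma> \<delta>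
  proof -
    have pt: "\<bar>max 0 (\<gamma> * z + 1) - max 0 (\<delta> * z + 1)\<bar> \<le> \<bar>z\<bar> * \<bar>\<gamma> - \<delta>\<bar>" for z :: real
    proof -
      have "\<bar>max 0 (\<gamma> * z + 1) - max 0 (\<delta> * z + 1)\<bar> \<le> \<bar>(\<gamma> * z + 1) - (\<delta> * z + 1)\<bar>"
        by linarith
      also have "\<dots> = \<bar>z\<bar> * \<bar>\<gamma> - \<delta>\<bar>"
        by (simp flip: abs_mult add: algebra_simps)
      finally show ?thesis .
    qed
    have "norm (hinge_mean M Z \<gamma> - hinge_mean M Z \<delta>)
        = norm (\<integral>\<omega>. max 0 (\<gamma> * Z \<omega> + 1) - max 0 (\<delta> * Z \<omega> + 1) \<partial>M)"
      unfolding hinge_mean_def using Z by (subst Bochner_Integration.integral_diff) auto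
    also have "\<dots> \<le> (\<integral>\<omega>. norm (max 0 (\<gamma> * Z \<omega> + 1) - max 0 (\<delta> * Z \<omega> + 1)) \<partial>M)"
      by (rule integral_norm_bound)
    also have "\<dots> \<le> (\<integral>\<omega>. \<bar>Z \<omega>\<bar> * \<bar>\<gamma> - \<delta>\<bar> \<partial>M)"
      using Z pt by (intro integral_mono integrable_norm Bochner_Integration.integrable_diff) auto
    finally show ?thesis using Z by simp
  qed
  then have "\<And>\<gamma> \<delta>. dist (hinge_mean M Z \<gamma>) (hinge_mean M Z \<delta>) \<le> (\<integral>\<omega>. \<bar>Z \<omega>\<bar> \<partial>M) * dist \<gamma> \<delta>"
    by (simp add: dist_norm)
  then have "(\<integral>\<omega>. \<bar>Z \<omega>\<bar> \<partial>M)-lipschitz_on A (hinge_mean M Z)"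
    by (intro lipschitz_onI Bochner_Integration.integral_nonneg) auto
  then show ?thesis
    by (rule lipschitz_on_continuous_on)
qed

text \<open>The right derivative of the hinge mean at zero is the expectation, so a negative expectation
  makes it dip below its value one at zero. Dominated convergence proves this: the error of the
  linearization at \<open>\<gamma> = 1/n\<close> is \<open>1/n\<close> times the mean of \<open>max 0 (-Z - n)\<close>.\<close>

lemma hinge_mean_less_1:
  assumes Z: "integrable M Z" and neg: "(\<integral>\<omega>. Z \<omega> \<partial>M) < 0"
  shows "\<exists>\<gamma>>0. hinge_mean M Z \<gamma> < 1"
proof -
  have [measurable]: "Z \<in> borel_measurable M"
    using Z by auto
  have "(\<lambda>n. \<integral>\<omega>. max 0 (- Z \<omega> - real n) \<partial>M) \<longlonglongrightarrow> (\<integral>\<omega>. 0 \<partial>M)"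
  proof (rule integral_dominated_convergence[where w = "\<lambda>\<omega>. \<bar>Z \<omega>\<bar>"])
    show "AE \<omega> in M. (\<lambda>n. max 0 (- Z \<omega> - real n)) \<longlonglongrightarrow> 0"
    proof (intro AE_I2)
      fix \<omega>
      have "\<forall>\<^sub>F n in sequentially. max 0 (- Z \<omega> - real n) = 0"
        using eventually_ge_at_top[of "nat \<lceil>- Z \<omega>\<rceil>"] by eventually_elim linarith
      then show "(\<lambda>n. max 0 (- Z \<omega> - real n)) \<longlonglongrightarrow> 0"
        by (rule tendsto_eventually)
    qed
  qed (use Z in auto)
  then have "\<forall>\<^sub>F n in sequentially. (\<integral>\<omega>. max 0 (- Z \<omega> - real n) \<partial>M) < - (\<integral>\<omega>. Z \<omega> \<partial>M)"
    using neg by (intro order_tendstoD) auto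
  then have "\<forall>\<^sub>F n in sequentially. 0 < n \<and> (\<integral>\<omega>. max 0 (- Z \<omega> - real n) \<partial>M) < - (\<integral>\<omega>. Z \<omega> \<partial>M)"
    using eventually_gt_at_top[of 0] by eventually_elim auto
  then obtain n where n: "0 < n" "(\<integral>\<omega>. max 0 (- Z \<omega> - real n) \<partial>M) < - (\<integral>\<omega>. Z \<omega> \<partial>M)"
    using eventually_happens'[OF sequentially_bot] by blast
  have I: "integrable M (\<lambda>\<omega>. max 0 (- Z \<omega> - real n))"
    using integrable_excess[of "\<lambda>\<omega>. - Z \<omega>"] Z by simp
  have pt: "max 0 (1 / real n * z + 1) = 1 + (z + max 0 (- z - real n)) / real n" for z
    using n by (auto simp: max_def field_simps)
  have "hinge_mean M Z (1 / real n) = 1 + ((\<integral>\<omega>. Z \<omega> \<partial>M) + (\<integral>\<omega>. max 0 (- Z \<omega> - real n) \<partial>M)) / real n"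
    unfolding hinge_mean_def pt using Z I by (simp add: prob_space)
  also have "\<dots> < 1"
    using n by (simp add: field_simps)
  finally show ?thesis
    using n by (intro exI[of _ "1 / real n"]) auto
qed

lemma hinge_mean_minimizer_exists:
  assumes Z: "integrable M Z" and fail: "failure_prob M Z \<noteq> 0"
  shows "\<exists>\<gamma>. is_arg_min (hinge_mean M Z) (\<lambda>\<gamma>. 0 \<le> \<gamma>) \<gamma>"
proof -
  let ?e = "mean_excess M Z 0"
  have e: "0 < ?e" by (rule mean_excess_pos[OF Z fail]) simp
  have "\<exists>\<gamma>\<in>{0..1 / ?e}. \<forall>\<delta>\<in>{0..1 / ?e}. hinge_mean M Z \<gamma> \<le> hinge_mean M Z \<delta>"
    using e by (intro continuous_attains_inf continuous_on_hinge_mean Z) auto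
  then obtain \<gamma> where \<gamma>: "0 \<le> \<gamma>" "\<And>\<delta>. 0 \<le> \<delta> \<Longrightarrow> \<delta> \<le> 1 / ?e \<Longrightarrow> hinge_mean M Z \<gamma> \<le> hinge_mean M Z \<delta>"
    by auto
  have "hinge_mean M Z \<gamma> \<le> hinge_mean M Z \<delta>" if "0 \<le> \<delta>" for \<delta>
  proof (cases "\<delta> \<le> 1 / ?e")
    case False
    have "hinge_mean M Z \<gamma> \<le> 1"
      using \<gamma>(2)[of 0] e by (simp add: hinge_mean_0)
    also have "1 \<le> \<delta> * ?e"
      using False e by (simp add: field_simps)
    also have "\<dots> \<le> hinge_mean M Z \<delta>"
      by (rule hinge_mean_lower[OF Z that])
    finally show ?thesis .
  qed (use \<gamma> that in auto)
  with \<gamma> show ?thesis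
    by (auto simp: is_arg_min_linorder)
qed

lemma hinge_mean_minimizer_pos:
  assumes Z: "integrable M Z" and neg: "(\<integral>\<omega>. Z \<omega> \<partial>M) < 0"
    and min: "is_arg_min (hinge_mean M Z) (\<lambda>\<gamma>. 0 \<le> \<gamma>) \<gamma>"
  shows "0 < \<gamma>" and "hinge_mean M Z \<gamma> < 1"
proof -
  obtain \<delta> where \<delta>: "0 < \<delta>" "hinge_mean M Z \<delta> < 1"
    using hinge_mean_less_1[OF Z neg] by blast
  with min show "hinge_mean M Z \<gamma> < 1"
    by (metis is_arg_min_linorder less_imp_le order_le_less_trans)
  then have "\<gamma> \<noteq> 0" by (auto simp: hinge_mean_0)
  with min show "0 < \<gamma>" by (auto simp: is_arg_min_def)
qed

text \<open>A level \<open>\<alpha>\<close> between zero and one has superquantile zero exactly if \<open>(1 - \<alpha>) * c + E[max 0 (Z - c)]\<close>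
  has minimum zero over \<open>c\<close>. A positive failure probability forces the points where it is zero to be
  negative, and division by \<open>-c = 1/\<gamma>\<close> turns this into \<open>1 - \<alpha>\<close> being the minimum of the hinge mean.
  The levels zero and one have a negative and a positive superquantile, respectively.\<close>

theorem buffered_failure_prob_eq_hinge_mean:
  assumes Z: "integrable M Z" and neg: "(\<integral>\<omega>. Z \<omega> \<partial>M) < 0" and fail: "failure_prob M Z \<noteq> 0"
    and min: "is_arg_min (hinge_mean M Z) (\<lambda>\<gamma>. 0 \<le> \<gamma>) \<gamma>"
  shows "buffered_failure_prob M Z = hinge_mean M Z \<gamma>"
proof -
  let ?h = "mean_excess M Z"
  define a where "a = 1 - hinge_mean M Z \<gamma>"
  have \<gamma>: "0 < \<gamma>" and less_1: "hinge_mean M Z \<gamma> < 1"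
    by (rule hinge_mean_minimizer_pos[OF Z neg min])+
  have min': "hinge_mean M Z \<gamma> \<le> hinge_mean M Z \<delta>" if "0 \<le> \<delta>" for \<delta>
    using min that by (auto simp: is_arg_min_linorder)
  have h_pos: "0 < ?h c" if "c \<le> 0" for c
    by (rule mean_excess_pos[OF Z fail that])
  have "0 < \<gamma> * ?h 0" using \<gamma> h_pos by simp
  also have "\<dots> \<le> hinge_mean M Z \<gamma>"
    using hinge_mean_lower[OF Z] \<gamma> by simp
  finally have a: "0 < a" "a < 1"
    using less_1 by (auto simp: a_def)
  have line: "0 \<le> (1 - a) * c + ?h c" for c
  proof (cases "c < 0")
    case True
    have "1 - a \<le> - 1 / c * ?h c"
      using min'[of "- 1 / c"] True hinge_mean_eq_mean_excess[of "- 1 / c" Z]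
      by (simp add: a_def)
    then show ?thesis using True by (simp add: field_simps)
  next
    case False
    then show ?thesis using a mean_excess_nonneg[of Z c] by (intro add_nonneg_nonneg mult_nonneg_nonneg) auto
  qed
  have osq: "open_superquantile M Z \<beta> = quantile M Z \<beta> + ?h (quantile M Z \<beta>) / (1 - \<beta>)" for \<beta>
    by (simp add: open_superquantile_def mean_excess_def)
  \<comment> \<open>At level \<open>a\<close> the variational bound is nonnegative in \<open>c\<close> and vanishes at \<open>c = -1/\<gamma>\<close>.\<close>
  have touch: "- 1 / \<gamma> + ?h (- 1 / \<gamma>) / (1 - a) = 0"
  proof -
    have "0 < ?h (- 1 / \<gamma>)"
      using \<gamma> by (intro h_pos) simp
    then show ?thesis
      using \<gamma> hinge_mean_eq_mean_excess[OF \<gamma>, of Z] by (simp add: a_def)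
  qed
  have line_frac: "0 \<le> c + ?h c / (1 - a)" for c
  proof -
    have "0 \<le> ((1 - a) * c + ?h c) / (1 - a)"
      using line[of c] a by (intro divide_nonneg_pos) auto
    also have "\<dots> = c + ?h c / (1 - a)"
      using a by (simp add: add_divide_distrib)
    finally show ?thesis .
  qed
  have "open_superquantile M Z a \<le> - 1 / \<gamma> + ?h (- 1 / \<gamma>) / (1 - a)"
    by (rule open_superquantile_le[OF Z a])
  also have "\<dots> = 0"
    by (rule touch)
  finally have "open_superquantile M Z a \<le> 0" .
  moreover have "0 \<le> open_superquantile M Z a"
    unfolding osq by (rule line_frac)
  ultimately have zero: "open_superquantile M Z a = 0" by simp
  \<comment> \<open>Strict growth beyond the level \<open>a\<close>: a vanishing mean excess only occurs at positive points,
    and a nonvanishing one gains from the larger weight \<open>1 / (1 - \<beta>)\<close>.\<close>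
  have pos: "0 < open_superquantile M Z \<beta>" if "a < \<beta>" "\<beta> < 1" for \<beta>
  proof (cases "?h (quantile M Z \<beta>) = 0")
    case True
    then have "0 < quantile M Z \<beta>"
      using h_pos[of "quantile M Z \<beta>"] by (cases "quantile M Z \<beta> \<le> 0") auto
    with True show ?thesis by (simp add: osq)
  next
    case False
    let ?q = "quantile M Z \<beta>"
    have h: "0 < ?h ?q" using False mean_excess_nonneg[of Z ?q] by simp
    have "0 \<le> ?q + ?h ?q / (1 - a)"
      by (rule line_frac)
    also have "\<dots> < ?q + ?h ?q / (1 - \<beta>)"
      using that h by (intro add_strict_left_mono divide_strict_left_mono) auto
    finally show ?thesis by (simp add: osq)
  qed
  have unique: "\<beta> = a" if "\<beta> \<in> {0..1}" "superquantile M Z \<beta> = 0" for \<beta>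
  proof -
    have "\<beta> \<noteq> 0"
      using that neg by (auto simp: superquantile_def)
    moreover have "\<beta> \<noteq> 1"
    proof
      assume "\<beta> = 1"
      have "0 < ereal (open_superquantile M Z ((a + 1) / 2))"
        using a pos[of "(a + 1) / 2"] by simp
      also have "\<dots> \<le> superquantile M Z 1"
        using a by (intro open_superquantile_le_superquantile_1 Z) auto
      finally show False using that \<open>\<beta> = 1\<close> by simp
    qed
    ultimately have \<beta>: "0 < \<beta>" "\<beta> < 1" "open_superquantile M Z \<beta> = 0"
      using that by (auto simp: superquantile_def)
    \<comment> \<open>Larger levels are excluded by strict growth; for smaller ones the point \<open>-1/\<gamma>\<close>, where the
      variational bound is zero at level \<open>a\<close>, already makes the superquantile negative.\<close>
    show "\<beta> = a"
    proof (rule ccontr)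
      assume "\<beta> \<noteq> a"
      with pos[of \<beta>] \<beta> have "\<beta> < a" by fastforce
      have "0 = open_superquantile M Z \<beta>" using \<beta> by simp
      also have "\<dots> \<le> - 1 / \<gamma> + ?h (- 1 / \<gamma>) / (1 - \<beta>)"
        by (rule open_superquantile_le[OF Z \<beta>(1,2)])
      also have "\<dots> < - 1 / \<gamma> + ?h (- 1 / \<gamma>) / (1 - a)"
        using \<open>\<beta> < a\<close> a \<beta> \<gamma> h_pos by (intro add_strict_left_mono divide_strict_left_mono) auto
      also have "\<dots> = 0"
        by (rule touch)
      finally show False by simp
    qed
  qed
  have "(THE \<alpha>. \<alpha> \<in> {0..1} \<and> superquantile M Z \<alpha> = 0) = a"
    using zero a unique by (intro the_equality) (auto simp: superquantile_def)
  then show ?thesis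
    using fail neg by (simp add: buffered_failure_prob_def a_def)
qed

end

section \<open>Zonotopes and the one-sided derivative of the hinge\<close>

text \<open>The right-hand side of the hypothesis is the support function, in direction \<open>d\<close>, of the zonotope of
  all combinations with coefficients in the given intervals. This zonotope is compact and convex,
  so a point outside of it is cut off by a hyperplane whose normal violates the hypothesis.\<close>

lemma zonotope_support_function:
  fixes a :: "'a::euclidean_space" and b :: "'i \<Rightarrow> 'a" and l u :: "'i \<Rightarrow> real"
  assumes fin: "finite I" and lu: "\<And>i. i \<in> I \<Longrightarrow> l i \<le> u i"
    and supp: "\<And>d. a \<bullet> d \<le> (\<Sum>i\<in>I. max (l i * (b i \<bullet> d)) (u i * (b i \<bullet> d)))"
  shows "\<exists>c. (\<forall>i\<in>I. c i \<in> {l i..u i}) \<and> a = (\<Sum>i\<in>I. c i *\<^sub>R b i)"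
proof -
  define S where "S J = {\<Sum>i\<in>J. c i *\<^sub>R b i |c. \<forall>i\<in>J. c i \<in> {l i..u i}}" for J
  have "compact (S J) \<and> convex (S J)" if "finite J" for J
    using that
  proof induction
    case empty
    then show ?case by (simp add: S_def)
  next
    case (insert j J)
    let ?T = "(\<lambda>r. r *\<^sub>R b j) ` {l j..u j}"
    have "S (insert j J) = {x + y |x y. x \<in> ?T \<and> y \<in> S J}" (is "_ = ?R")
    proof (intro equalityI subsetI)
      fix z assume "z \<in> S (insert j J)"
      then obtain c where c: "\<forall>i\<in>insert j J. c i \<in> {l i..u i}"
        and "z = (\<Sum>i\<in>insert j J. c i *\<^sub>R b i)"
        unfolding S_def by blast
      then have "z = c j *\<^sub>R b j + (\<Sum>i\<in>J. c i *\<^sub>R b i)"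
        using insert.hyps by simp
      moreover have "c j *\<^sub>R b j \<in> ?T" "(\<Sum>i\<in>J. c i *\<^sub>R b i) \<in> S J"
        using c unfolding S_def by blast+
      ultimately show "z \<in> ?R" by blast
    next
      fix z assume "z \<in> ?R"
      then obtain r c where r: "r \<in> {l j..u j}" and c: "\<forall>i\<in>J. c i \<in> {l i..u i}"
        and z: "z = r *\<^sub>R b j + (\<Sum>i\<in>J. c i *\<^sub>R b i)"
        by (auto simp: S_def)
      have "(\<Sum>i\<in>J. (c(j := r)) i *\<^sub>R b i) = (\<Sum>i\<in>J. c i *\<^sub>R b i)"
        using insert.hyps by (intro sum.cong) auto
      then have "z = (\<Sum>i\<in>insert j J. (c(j := r)) i *\<^sub>R b i)"
        using insert.hyps z by simp
      then show "z \<in> S (insert j J)"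
        unfolding S_def using r c by (intro CollectI exI[of _ "c(j := r)"] conjI) auto
    qed
    moreover have "compact ?T"
      by (intro compact_continuous_image continuous_intros) auto
    moreover have "convex ?T"
      by (intro convex_linear_image convex_real_interval bounded_linear.linear bounded_linear_scaleR_left)
    moreover have "{x + y |x y. x \<in> ?T \<and> y \<in> S J} = (\<Union>x\<in>?T. \<Union>y\<in>S J. {x + y})"
      by blast
    ultimately show ?case
      using insert.IH compact_sums[of ?T "S J"] convex_sums[of ?T "S J"] by simp
  qed
  then have S: "closed (S I)" "convex (S I)"
    using fin compact_imp_closed by auto
  have "a \<in> S I"
  proof (rule ccontr)
    assume "a \<notin> S I"
    then obtain w \<beta> where w: "w \<bullet> a < \<beta>" "\<forall>x\<in>S I. \<beta> < w \<bullet> x"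
      using separating_hyperplane_closed_point[OF S(2,1)] by metis
    \<comment> \<open>The vertex of the zonotope that is extreme in direction \<open>-w\<close>.\<close>
    define c where "c i = (if u i * (b i \<bullet> (- w)) \<le> l i * (b i \<bullet> (- w)) then l i else u i)" for i
    have "(\<Sum>i\<in>I. c i *\<^sub>R b i) \<in> S I"
      using lu by (auto simp: S_def c_def)
    then have "w \<bullet> a < w \<bullet> (\<Sum>i\<in>I. c i *\<^sub>R b i)"
      using w by fastforce
    moreover have "a \<bullet> (- w) \<le> (\<Sum>i\<in>I. c i * (b i \<bullet> (- w)))"
      using supp[of "- w"] by (rule order_trans) (intro sum_mono, auto simp: c_def)
    ultimately show False
      by (simp add: inner_sum_right inner_commute sum_negf)
  qed
  then show ?thesis
    by (auto simp: S_def)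
qed

text \<open>The subdifferential of the convex function \<open>\<lambda>u. max 0 u\<close>, written as the interval between its
  one-sided derivatives because these serve as coefficient bounds of a zonotope.\<close>

definition hinge_subdifferential :: "real \<Rightarrow> real set" where
  "hinge_subdifferential u = {of_bool (u > 0)..of_bool (u \<ge> 0)}"

lemma hinge_subdifferential_eq:
  "hinge_subdifferential u = (if u < 0 then {0} else if u = 0 then {0..1} else {1})"
  by (auto simp: hinge_subdifferential_def)

lemma hinge_right_derivative:
  fixes U :: "real \<Rightarrow> real"
  assumes U: "(U has_real_derivative w) (at_right 0)"
  shows "((\<lambda>t. (max 0 (U t) - max 0 (U 0)) / t) \<longlongrightarrow> max (of_bool (U 0 > 0) * w) (of_bool (U 0 \<ge> 0) * w))
           (at_right 0)"
proof -
  have lim: "((\<lambda>t. (U t - U 0) / t) \<longlongrightarrow> w) (at_right 0)"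
    using U by (simp add: has_field_derivative_iff)
  have cont: "(U \<longlongrightarrow> U 0) (at_right 0)"
    using DERIV_continuous[OF U] by (simp add: continuous_within)
  have t_pos: "\<forall>\<^sub>F t in at_right 0. (0::real) < t"
    by (simp add: eventually_at_right_less)
  consider "U 0 < 0" | "U 0 = 0" | "U 0 > 0" by linarith
  then show ?thesis
  proof cases
    case 1
    have "\<forall>\<^sub>F t in at_right 0. 0 = (max 0 (U t) - max 0 (U 0)) / t"
      using order_tendstoD(2)[OF cont 1] by eventually_elim (use 1 in auto)
    then show ?thesis
      using 1 by (auto intro: Lim_transform_eventually[OF tendsto_const])
  next
    case 2
    have "((\<lambda>t. max 0 ((U t - U 0) / t)) \<longlongrightarrow> max 0 w) (at_right 0)"
      by (intro tendsto_max tendsto_const lim)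
    moreover have "\<forall>\<^sub>F t in at_right 0. max 0 ((U t - U 0) / t) = (max 0 (U t) - max 0 (U 0)) / t"
      using t_pos by eventually_elim (use 2 in \<open>auto simp: max_def field_simps\<close>)
    ultimately show ?thesis
      using 2 by (simp add: Lim_transform_eventually)
  next
    case 3
    have "\<forall>\<^sub>F t in at_right 0. (U t - U 0) / t = (max 0 (U t) - max 0 (U 0)) / t"
      using order_tendstoD(1)[OF cont 3] by eventually_elim (use 3 in auto)
    then show ?thesis
      using 3 lim by (simp add: Lim_transform_eventually)
  qed
qed

section \<open>Regular subgradients of functions below a hinge mean\<close>

lemma regular_subgradient_real_bound:
  fixes f :: "'a::real_inner \<Rightarrow> real"
  assumes "regular_subgradient (\<lambda>x. ereal (f x)) x v" and "0 < \<epsilon>"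
  shows "\<forall>\<^sub>F x' in nhds x. f x + v \<bullet> (x' - x) - \<epsilon> * norm (x' - x) \<le> f x'"
proof -
  obtain r where r: "r \<in> o[at x](\<lambda>x'. norm (x' - x))"
    and ev: "\<forall>\<^sub>F x' in at x. f x + v \<bullet> (x' - x) + r x' \<le> f x'"
    using assms(1) by (auto simp: regular_subgradient_def)
  have "\<forall>\<^sub>F x' in at x. norm (r x') \<le> \<epsilon> * norm (norm (x' - x))"
    using landau_o.smallD[OF r \<open>0 < \<epsilon>\<close>] .
  with ev have "\<forall>\<^sub>F x' in at x. f x + v \<bullet> (x' - x) - \<epsilon> * norm (x' - x) \<le> f x'"
    by eventually_elim auto
  then show ?thesis
    unfolding eventually_at_filter by (rule eventually_mono) fastforce
qed

text \<open>Along the ray from \<open>x\<close> in direction \<open>d\<close>, the difference quotients of a majorant that touches \<open>f\<close> at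
  \<open>x\<close> dominate those of \<open>f\<close>, which are at least \<open>v \<bullet> d\<close> up to an arbitrarily small error.\<close>

lemma regular_subgradient_le_directional:
  fixes f :: "'a::real_inner \<Rightarrow> real" and \<Phi> :: "real \<Rightarrow> real"
  assumes sub: "regular_subgradient (\<lambda>x. ereal (f x)) x v"
    and major: "\<forall>\<^sub>F t in at_right 0. f (x + t *\<^sub>R d) \<le> \<Phi> t" and touch: "f x = \<Phi> 0"
    and lim: "((\<lambda>t. (\<Phi> t - \<Phi> 0) / t) \<longlongrightarrow> D) (at_right 0)"
  shows "v \<bullet> d \<le> D"
proof (rule field_le_epsilon)
  fix e :: real assume "0 < e"
  define \<epsilon> where "\<epsilon> = e / (norm d + 1)"
  have \<epsilon>: "0 < \<epsilon>" using \<open>0 < e\<close> by (auto simp: \<epsilon>_def intro!: divide_pos_pos add_nonneg_pos)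
  have "((\<lambda>t. x + t *\<^sub>R d) \<longlongrightarrow> x + 0 *\<^sub>R d) (at_right 0)"
    by (intro tendsto_intros)
  then have "filterlim (\<lambda>t. x + t *\<^sub>R d) (nhds x) (at_right 0)"
    by simp
  from eventually_compose_filterlim[OF regular_subgradient_real_bound[OF sub \<epsilon>] this]
  have "\<forall>\<^sub>F t in at_right 0. f x + v \<bullet> (t *\<^sub>R d) - \<epsilon> * norm (t *\<^sub>R d) \<le> f (x + t *\<^sub>R d)"
    by simp
  moreover have "\<forall>\<^sub>F t in at_right 0. (0::real) < t"
    by (simp add: eventually_at_right_less)
  ultimately have "\<forall>\<^sub>F t in at_right 0. v \<bullet> d - \<epsilon> * norm d \<le> (\<Phi> t - \<Phi> 0) / t"
    using major
  proof eventually_elim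
    case (elim t)
    then have "t * (v \<bullet> d - \<epsilon> * norm d) \<le> \<Phi> t - \<Phi> 0"
      using touch by (simp add: algebra_simps)
    with elim show ?case
      by (simp add: field_simps)
  qed
  then have "v \<bullet> d - \<epsilon> * norm d \<le> D"
    by (intro tendsto_lowerbound[OF lim]) auto
  moreover have "\<epsilon> * norm d \<le> e"
    using \<open>0 < e\<close> by (simp add: \<epsilon>_def field_simps add_pos_nonneg)
  ultimately show "v \<bullet> d \<le> D + e" by simp
qed

text \<open>The pair \<open>(0, v)\<close> is a regular subgradient of the hinge mean as a function of \<open>\<gamma>\<close> and \<open>x\<close> jointly.
  Its one-sided directional derivative is the support function of a zonotope generated by the vectors
  \<open>p i *\<^sub>R (G i x, \<gamma> *\<^sub>R D i)\<close>, and the two components of the resulting representation are the two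
  equations for the multipliers.\<close>

lemma regular_subgradient_hinge_multipliers:
  fixes f :: "'a::euclidean_space \<Rightarrow> real" and G :: "'i \<Rightarrow> 'a \<Rightarrow> real"
  assumes fin: "finite I" and p: "\<And>i. i \<in> I \<Longrightarrow> 0 \<le> p i"
    and deriv: "\<And>i. i \<in> I \<Longrightarrow> GDERIV (G i) x :> D i"
    and \<gamma>: "0 < \<gamma>"
    and major: "\<forall>\<^sub>F x' in nhds x. \<forall>\<delta>\<ge>0. f x' \<le> (\<Sum>i\<in>I. p i * max 0 (\<delta> * G i x' + 1))"
    and touch: "f x = (\<Sum>i\<in>I. p i * max 0 (\<gamma> * G i x + 1))"
    and sub: "regular_subgradient (\<lambda>x. ereal (f x)) x v"
  shows "\<exists>\<mu>. (\<forall>i\<in>I. \<mu> i \<in> hinge_subdifferential (\<gamma> * G i x + 1)) \<and>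
             v = \<gamma> *\<^sub>R (\<Sum>i\<in>I. (p i * \<mu> i) *\<^sub>R D i) \<and> (\<Sum>i\<in>I. p i * \<mu> i * G i x) = 0"
proof -
  define l u :: "'i \<Rightarrow> real"
    where "l i = of_bool (\<gamma> * G i x + 1 > 0)" and "u i = of_bool (\<gamma> * G i x + 1 \<ge> 0)" for i
  define b where "b i = p i *\<^sub>R (G i x, \<gamma> *\<^sub>R D i)" for i
  have "(0, v) \<bullet> sd \<le> (\<Sum>i\<in>I. max (l i * (b i \<bullet> sd)) (u i * (b i \<bullet> sd)))" for sd :: "real \<times> 'a"
  proof -
    obtain s d where sd: "sd = (s, d)" by (cases sd)
    define U where "U i t = (\<gamma> + t * s) * G i (x + t *\<^sub>R d) + 1" for i t
    define w where "w i = s * G i x + \<gamma> * (D i \<bullet> d)" for i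
    have U0: "U i 0 = \<gamma> * G i x + 1" for i
      by (simp add: U_def)
    have dU: "(U i has_real_derivative w i) (at_right 0)" if "i \<in> I" for i
    proof -
      have "(G i has_derivative (\<lambda>h. h \<bullet> D i)) (at (x + 0 *\<^sub>R d))"
        using deriv[OF that] by (simp add: gderiv_def)
      moreover have "((\<lambda>t. x + t *\<^sub>R d) has_derivative (\<lambda>t. t *\<^sub>R d)) (at 0)"
        by (auto intro!: derivative_eq_intros)
      ultimately have "((\<lambda>t. G i (x + t *\<^sub>R d)) has_derivative (\<lambda>t. (t *\<^sub>R d) \<bullet> D i)) (at 0)"
        by (rule has_derivative_compose[rotated])
      then have "((\<lambda>t. G i (x + t *\<^sub>R d)) has_real_derivative D i \<bullet> d) (at 0)"
        by (simp add: has_field_derivative_def inner_commute mult_commute_abs)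
      then have "(U i has_real_derivative w i) (at 0)"
        unfolding U_def w_def by (auto intro!: derivative_eq_intros)
      then show ?thesis
        by (rule has_field_derivative_at_within)
    qed
    have "v \<bullet> d \<le> (\<Sum>i\<in>I. p i * max (l i * w i) (u i * w i))"
    proof (rule regular_subgradient_le_directional[OF sub])
      have "((\<lambda>t. x + t *\<^sub>R d) \<longlongrightarrow> x + 0 *\<^sub>R d) (at_right 0)"
        by (intro tendsto_intros)
      then have "filterlim (\<lambda>t. x + t *\<^sub>R d) (nhds x) (at_right 0)"
        by simp
      note eventually_compose_filterlim[OF major this]
      moreover have "((\<lambda>t. \<gamma> + t * s) \<longlongrightarrow> \<gamma> + 0 * s) (at_right 0)"
        by (intro tendsto_intros)
      then have "\<forall>\<^sub>F t in at_right 0. 0 < \<gamma> + t * s"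
        using \<gamma> by (intro order_tendstoD) auto
      ultimately show "\<forall>\<^sub>F t in at_right 0. f (x + t *\<^sub>R d) \<le> (\<Sum>i\<in>I. p i * max 0 (U i t))"
        unfolding U_def by eventually_elim auto
      show "f x = (\<Sum>i\<in>I. p i * max 0 (U i 0))"
        by (simp add: touch U0)
      have "((\<lambda>t. \<Sum>i\<in>I. p i * ((max 0 (U i t) - max 0 (U i 0)) / t))
              \<longlongrightarrow> (\<Sum>i\<in>I. p i * max (l i * w i) (u i * w i))) (at_right 0)"
        unfolding l_def u_def U0[symmetric]
        by (intro tendsto_sum tendsto_mult tendsto_const hinge_right_derivative dU)
      then show "((\<lambda>t. ((\<Sum>i\<in>I. p i * max 0 (U i t)) - (\<Sum>i\<in>I. p i * max 0 (U i 0))) / t)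
              \<longlongrightarrow> (\<Sum>i\<in>I. p i * max (l i * w i) (u i * w i))) (at_right 0)"
        by (simp add: sum_subtractf[symmetric] right_diff_distrib[symmetric] sum_divide_distrib)
    qed
    also have "\<dots> = (\<Sum>i\<in>I. max (l i * (b i \<bullet> sd)) (u i * (b i \<bullet> sd)))"
    proof (intro sum.cong refl)
      fix i assume "i \<in> I"
      have "b i \<bullet> sd = p i * w i"
        by (simp add: b_def sd w_def algebra_simps)
      then show "p i * max (l i * w i) (u i * w i) = max (l i * (b i \<bullet> sd)) (u i * (b i \<bullet> sd))"
        using max_mult_distrib_left[of "p i" "l i * w i" "u i * w i"] p[OF \<open>i \<in> I\<close>]
        by (simp add: mult.left_commute)
    qed
    finally show ?thesis by (simp add: sd)
  qed
  then have "\<exists>\<mu>. (\<forall>i\<in>I. \<mu> i \<in> {l i..u i}) \<and> (0, v) = (\<Sum>i\<in>I. \<mu> i *\<^sub>R b i)"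
    by (intro zonotope_support_function fin) (auto simp: l_def u_def)
  then obtain \<mu> where \<mu>: "\<And>i. i \<in> I \<Longrightarrow> \<mu> i \<in> {l i..u i}" and eq: "(0, v) = (\<Sum>i\<in>I. \<mu> i *\<^sub>R b i)"
    by blast
  have "0 = (\<Sum>i\<in>I. p i * \<mu> i * G i x)"
    using arg_cong[OF eq, of fst] by (simp add: b_def fst_sum mult_ac)
  moreover have "v = \<gamma> *\<^sub>R (\<Sum>i\<in>I. (p i * \<mu> i) *\<^sub>R D i)"
    using arg_cong[OF eq, of snd] by (simp add: b_def snd_sum scaleR_sum_right mult_ac)
  ultimately show ?thesis
    using \<mu> by (intro exI[of _ \<mu>]) (auto simp: hinge_subdifferential_def l_def u_def)
qed

section \<open>Limiting subgradients\<close>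

lemma hinge_subdifferential_closed_graph:
  assumes u: "u \<longlonglongrightarrow> u0" and m: "m \<longlonglongrightarrow> m0"
    and mem: "\<And>k. m k \<in> hinge_subdifferential (u k)"
  shows "m0 \<in> hinge_subdifferential u0"
proof -
  consider "u0 < 0" | "u0 = 0" | "u0 > 0" by linarith
  then show ?thesis
  proof cases
    case 1
    have "\<forall>\<^sub>F k in sequentially. m k = 0"
      using order_tendstoD(2)[OF u 1]
    proof eventually_elim
      case (elim k)
      then show ?case using mem[of k] by (simp add: hinge_subdifferential_eq)
    qed
    then have "m0 = 0"
      using m by (metis LIMSEQ_unique tendsto_eventually)
    with 1 show ?thesis by (simp add: hinge_subdifferential_eq)
  next
    case 2
    have "m k \<in> {0..1}" for k
      using mem[of k] by (auto simp: hinge_subdifferential_eq split: if_splits)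
    then have "m0 \<in> {0..1}"
      using m by (meson closed_atLeastAtMost closed_sequentially)
    with 2 show ?thesis by (simp add: hinge_subdifferential_eq)
  next
    case 3
    have "\<forall>\<^sub>F k in sequentially. m k = 1"
      using order_tendstoD(1)[OF u 3]
    proof eventually_elim
      case (elim k)
      then show ?case using mem[of k] by (simp add: hinge_subdifferential_eq)
    qed
    then have "m0 = 1"
      using m by (metis LIMSEQ_unique tendsto_eventually)
    with 3 show ?thesis by (simp add: hinge_subdifferential_eq)
  qed
qed

lemma compact_unit_cube: "compact {\<mu> :: 'i \<Rightarrow> real. \<forall>i. \<mu> i \<in> {0..1}}"
proof -
  have "compactin (product_topology (\<lambda>i::'i. euclidean) UNIV) (PiE UNIV (\<lambda>i. {0..1::real}))"
    by (simp add: compactin_PiE)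
  then have "compact (PiE UNIV (\<lambda>i::'i. {0..1::real}))"
    by (simp add: euclidean_product_topology)
  also have "PiE UNIV (\<lambda>i::'i. {0..1::real}) = {\<mu>. \<forall>i. \<mu> i \<in> {0..1}}"
    by (auto simp: PiE_UNIV_domain)
  finally show ?thesis .
qed

lemma smooth_near_eventually_GDERIV:
  assumes "smooth_near f x"
  shows "\<forall>\<^sub>F z in nhds x. GDERIV f z :> grad f z"
  using assms unfolding smooth_near_def eventually_nhds by blast

lemma smooth_near_isCont:
  assumes "smooth_near f x"
  shows "isCont f x" and "isCont (grad f) x"
proof -
  obtain U where U: "open U" "x \<in> U" "\<forall>u\<in>U. GDERIV f u :> grad f u" "continuous_on U (grad f)"
    using assms by (auto simp: smooth_near_def)
  then show "isCont f x"
    by (auto simp: gderiv_def intro: has_derivative_continuous)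
  show "isCont (grad f) x"
    using U continuous_on_eq_continuous_at by blast
qed

text \<open>Near \<open>x\<close> the minimizers \<open>\<gamma>\<close> stay bounded because the outcome \<open>j\<close> with positive value makes the
  hinge mean grow linearly, and the multipliers live in a cube. Along a subsequence of the regular
  subgradients both converge, and every condition in the conclusion is closed under such limits.\<close>

theorem subgradient_hinge_multipliers:
  fixes f :: "'a::euclidean_space \<Rightarrow> real" and G :: "'i::countable \<Rightarrow> 'a \<Rightarrow> real"
  defines "\<phi> \<equiv> \<lambda>I p x \<gamma>. \<Sum>i\<in>I. p i * max 0 (\<gamma> * G i x + 1)"
  assumes fin: "finite I" and p: "\<And>i. i \<in> I \<Longrightarrow> 0 < p i"
    and smooth: "\<And>i. i \<in> I \<Longrightarrow> smooth_near (G i) x"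
    and j: "j \<in> I" "0 < G j x"
    and local_min: "\<forall>\<^sub>F x' in nhds x. \<exists>\<gamma>>0. is_arg_min (\<phi> I p x') (\<lambda>\<gamma>. 0 \<le> \<gamma>) \<gamma> \<and> f x' = \<phi> I p x' \<gamma>"
    and y: "y \<in> subgradients (\<lambda>x. ereal (f x)) x"
  shows "\<exists>\<gamma> \<mu>. is_arg_min (\<phi> I p x) (\<lambda>\<gamma>. 0 \<le> \<gamma>) \<gamma> \<and>
             (\<forall>i\<in>I. \<mu> i \<in> hinge_subdifferential (\<gamma> * G i x + 1)) \<and>
             y = \<gamma> *\<^sub>R (\<Sum>i\<in>I. (p i * \<mu> i) *\<^sub>R grad (G i) x) \<and> (\<Sum>i\<in>I. p i * \<mu> i * G i x) = 0"
proof -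
  let ?m = "\<lambda>x' \<gamma>. is_arg_min (\<phi> I p x') (\<lambda>\<gamma>. 0 \<le> \<gamma>) \<gamma>"
  obtain X V where X: "X \<longlonglongrightarrow> x" and V: "V \<longlonglongrightarrow> y"
    and reg: "\<And>k::nat. regular_subgradient (\<lambda>x. ereal (f x)) (X k) (V k)"
    using y by (auto simp: subgradients_def)
  \<comment> \<open>Bounds the minimizers, since \<open>\<gamma> * p j * G j x' \<le> \<phi> I p x' \<gamma> \<le> \<phi> I p x' 0\<close> and
    \<open>G j x / 2 < G j x'\<close> near \<open>x\<close>.\<close>
  define B where "B = (\<Sum>i\<in>I. p i) / (p j * (G j x / 2))"
  define Q where "Q x' \<gamma> \<mu> v \<longleftrightarrow> ?m x' \<gamma> \<and> \<gamma> \<in> {0..B} \<and> (\<forall>i. \<mu> i \<in> {0..1}) \<and>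
      (\<forall>i\<in>I. \<mu> i \<in> hinge_subdifferential (\<gamma> * G i x' + 1)) \<and>
      v = \<gamma> *\<^sub>R (\<Sum>i\<in>I. (p i * \<mu> i) *\<^sub>R grad (G i) x') \<and> (\<Sum>i\<in>I. p i * \<mu> i * G i x') = 0"
    for x' \<gamma> \<mu> v
  have "\<forall>\<^sub>F x' in nhds x. G j x / 2 < G j x'"
    using smooth_near_isCont(1)[OF smooth[OF j(1)]] j(2)
    by (intro order_tendstoD(1)[of "G j" "G j x"]) (auto simp: isCont_def tendsto_at_iff_tendsto_nhds)
  moreover have "\<forall>\<^sub>F x' in nhds x. \<forall>i\<in>I. GDERIV (G i) x' :> grad (G i) x'"
    using fin smooth by (intro eventually_ball_finite) (auto intro: smooth_near_eventually_GDERIV)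
  moreover have "\<forall>\<^sub>F x' in nhds x. \<forall>\<^sub>F x'' in nhds x'. \<exists>\<gamma>>0. ?m x'' \<gamma> \<and> f x'' = \<phi> I p x'' \<gamma>"
    using local_min by (simp add: eventually_eventually)
  ultimately have "\<forall>\<^sub>F x' in nhds x. \<forall>v. regular_subgradient (\<lambda>x. ereal (f x)) x' v \<longrightarrow> (\<exists>\<gamma> \<mu>. Q x' \<gamma> \<mu> v)"
    using local_min
  proof eventually_elim
    case (elim x')
    then obtain \<gamma> where \<gamma>: "0 < \<gamma>" "?m x' \<gamma>" "f x' = \<phi> I p x' \<gamma>"
      by blast
    have "\<gamma> * (p j * (G j x / 2)) \<le> p j * max 0 (\<gamma> * G j x' + 1)"
    proof -
      have "\<gamma> * (G j x / 2) \<le> \<gamma> * G j x'"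
        using elim(1) \<gamma>(1) by (intro mult_left_mono) auto
      also have "\<dots> \<le> max 0 (\<gamma> * G j x' + 1)"
        by (rule max.coboundedI2) simp
      finally have "\<gamma> * (G j x / 2) \<le> max 0 (\<gamma> * G j x' + 1)" .
      then have "p j * (\<gamma> * (G j x / 2)) \<le> p j * max 0 (\<gamma> * G j x' + 1)"
        using p[OF j(1)] by (intro mult_left_mono) auto
      then show ?thesis by (simp add: mult_ac)
    qed
    also have "\<dots> \<le> \<phi> I p x' \<gamma>"
      unfolding \<phi>_def using fin j(1) p by (intro member_le_sum) (auto simp: less_imp_le intro!: mult_nonneg_nonneg)
    also have "\<dots> \<le> \<phi> I p x' 0"
      using \<gamma>(2) by (auto simp: is_arg_min_linorder)
    finally have "\<gamma> \<le> B"
      using p[OF j(1)] j(2) by (simp add: B_def \<phi>_def pos_le_divide_eq)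
    have major: "\<forall>\<^sub>F x'' in nhds x'. \<forall>\<delta>\<ge>0. f x'' \<le> (\<Sum>i\<in>I. p i * max 0 (\<delta> * G i x'' + 1))"
      using elim(3) by eventually_elim (auto simp: is_arg_min_linorder \<phi>_def)
    show ?case
    proof (intro allI impI)
      fix v assume "regular_subgradient (\<lambda>x. ereal (f x)) x' v"
      then obtain \<mu> where \<mu>: "\<forall>i\<in>I. \<mu> i \<in> hinge_subdifferential (\<gamma> * G i x' + 1)"
        "v = \<gamma> *\<^sub>R (\<Sum>i\<in>I. (p i * \<mu> i) *\<^sub>R grad (G i) x')" "(\<Sum>i\<in>I. p i * \<mu> i * G i x') = 0"
        using regular_subgradient_hinge_multipliers[of I p G x' "\<lambda>i. grad (G i) x'" \<gamma> f v]
          fin p elim(2) \<gamma>(1) major \<gamma>(3)[unfolded \<phi>_def] by (auto simp: less_imp_le)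
      have "\<mu> i \<in> {0..1}" if "i \<in> I" for i
        using bspec[OF \<mu>(1) that] by (auto simp: hinge_subdifferential_eq split: if_splits)
      \<comment> \<open>Multipliers of absent indices are set to zero to put the whole function into the cube.\<close>
      then have "Q x' \<gamma> (\<lambda>i. if i \<in> I then \<mu> i else 0) v"
        unfolding Q_def using \<gamma> \<open>\<gamma> \<le> B\<close> \<mu> by (auto intro!: sum.cong)
      then show "\<exists>\<gamma> \<mu>. Q x' \<gamma> \<mu> v" by blast
    qed
  qed
  from eventually_compose_filterlim[OF this X] reg
  have "\<forall>\<^sub>F k in sequentially. \<exists>\<gamma> \<mu>. Q (X k) \<gamma> \<mu> (V k)"
    by (auto elim: eventually_mono)
  then obtain K where "\<And>k. k \<ge> K \<Longrightarrow> \<exists>\<gamma> \<mu>. Q (X k) \<gamma> \<mu> (V k)"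
    unfolding eventually_sequentially by blast
  then have "\<forall>k. \<exists>s. Q (X (k + K)) (fst s) (snd s) (V (k + K))"
    by simp
  then obtain s where s: "\<And>k. Q (X (k + K)) (fst (s k)) (snd (s k)) (V (k + K))"
    by metis
  have "compact ({0..B} \<times> {\<mu> :: 'i \<Rightarrow> real. \<forall>i. \<mu> i \<in> {0..1}})"
    by (intro compact_Times compact_unit_cube compact_Icc)
  \<comment> \<open>The index type is countable, so the function space is metrizable and compactness gives
    convergent subsequences, for all multipliers at once.\<close>
  then have "seq_compact ({0..B} \<times> {\<mu> :: 'i \<Rightarrow> real. \<forall>i. \<mu> i \<in> {0..1}})"
    by (rule compact_imp_seq_compact)
  moreover have "\<forall>k. s k \<in> {0..B} \<times> {\<mu>. \<forall>i. \<mu> i \<in> {0..1}}"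
    using s by (auto simp: Q_def mem_Times_iff)
  ultimately obtain c r where c: "c \<in> {0..B} \<times> {\<mu>. \<forall>i. \<mu> i \<in> {0..1}}"
    and r: "strict_mono (r :: nat \<Rightarrow> nat)" and lim: "(s \<circ> r) \<longlonglongrightarrow> c"
    by (rule seq_compactE)
  define x' v \<gamma>' \<mu>' where "x' k = X (r k + K)" and "v k = V (r k + K)"
    and "\<gamma>' k = fst (s (r k))" and "\<mu>' k = snd (s (r k))" for k
  define \<gamma> \<mu> where "\<gamma> = fst c" and "\<mu> = snd c"
  have Qk: "Q (x' k) (\<gamma>' k) (\<mu>' k) (v k)" for k
    using s by (simp add: x'_def v_def \<gamma>'_def \<mu>'_def)
  have \<gamma>_lim: "\<gamma>' \<longlonglongrightarrow> \<gamma>"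
    using tendsto_fst[OF lim] by (simp add: \<gamma>'_def[abs_def] \<gamma>_def o_def)
  have "\<mu>' \<longlonglongrightarrow> \<mu>"
    using tendsto_snd[OF lim] by (simp add: \<mu>'_def[abs_def] \<mu>_def o_def)
  then have \<mu>_lim: "(\<lambda>k. \<mu>' k i) \<longlonglongrightarrow> \<mu> i" for i
    using continuous_on_tendsto_compose[OF continuous_on_product_coordinates[of i]] by simp
  have x_lim: "x' \<longlonglongrightarrow> x" and v_lim: "v \<longlonglongrightarrow> y"
    using LIMSEQ_subseq_LIMSEQ[OF LIMSEQ_ignore_initial_segment[OF X, of K] r]
      LIMSEQ_subseq_LIMSEQ[OF LIMSEQ_ignore_initial_segment[OF V, of K] r]
    by (simp_all add: x'_def[abs_def] v_def[abs_def] o_def)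
  have G_lim: "(\<lambda>k. G i (x' k)) \<longlonglongrightarrow> G i x" and D_lim: "(\<lambda>k. grad (G i) (x' k)) \<longlonglongrightarrow> grad (G i) x"
    if "i \<in> I" for i
    using smooth_near_isCont[OF smooth[OF that]] x_lim by (auto intro: isCont_tendsto_compose)
  have "?m x \<gamma>"
  proof -
    have "\<phi> I p x \<gamma> \<le> \<phi> I p x \<delta>" if "0 \<le> \<delta>" for \<delta>
    proof (rule LIMSEQ_le)
      show "(\<lambda>k. \<phi> I p (x' k) (\<gamma>' k)) \<longlonglongrightarrow> \<phi> I p x \<gamma>" "(\<lambda>k. \<phi> I p (x' k) \<delta>) \<longlonglongrightarrow> \<phi> I p x \<delta>"
        unfolding \<phi>_def by (intro tendsto_intros tendsto_max \<gamma>_lim G_lim; assumption)+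
      show "\<exists>N. \<forall>k\<ge>N. \<phi> I p (x' k) (\<gamma>' k) \<le> \<phi> I p (x' k) \<delta>"
        using Qk that by (auto simp: Q_def is_arg_min_linorder)
    qed
    then show ?thesis
      using c by (auto simp: is_arg_min_linorder \<gamma>_def)
  qed
  moreover have "\<mu> i \<in> hinge_subdifferential (\<gamma> * G i x + 1)" if "i \<in> I" for i
  proof (rule hinge_subdifferential_closed_graph)
    show "(\<lambda>k. \<gamma>' k * G i (x' k) + 1) \<longlonglongrightarrow> \<gamma> * G i x + 1"
      by (intro tendsto_intros \<gamma>_lim G_lim that)
    show "\<mu>' k i \<in> hinge_subdifferential (\<gamma>' k * G i (x' k) + 1)" for k
      using Qk that by (auto simp: Q_def)
  qed (rule \<mu>_lim)
  moreover have "y = \<gamma> *\<^sub>R (\<Sum>i\<in>I. (p i * \<mu> i) *\<^sub>R grad (G i) x)"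
  proof (rule LIMSEQ_unique[OF v_lim])
    have "v = (\<lambda>k. \<gamma>' k *\<^sub>R (\<Sum>i\<in>I. (p i * \<mu>' k i) *\<^sub>R grad (G i) (x' k)))"
      using Qk by (auto simp: Q_def)
    also have "\<dots> \<longlonglongrightarrow> \<gamma> *\<^sub>R (\<Sum>i\<in>I. (p i * \<mu> i) *\<^sub>R grad (G i) x)"
      by (intro tendsto_intros \<gamma>_lim \<mu>_lim D_lim; assumption)
    finally show "v \<longlonglongrightarrow> \<gamma> *\<^sub>R (\<Sum>i\<in>I. (p i * \<mu> i) *\<^sub>R grad (G i) x)" .
  qed
  moreover have "(\<Sum>i\<in>I. p i * \<mu> i * G i x) = 0"
  proof (rule LIMSEQ_unique)
    show "(\<lambda>k. \<Sum>i\<in>I. p i * \<mu>' k i * G i (x' k)) \<longlonglongrightarrow> (\<Sum>i\<in>I. p i * \<mu> i * G i x)"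
      by (intro tendsto_intros \<mu>_lim G_lim; assumption)
    show "(\<lambda>k. \<Sum>i\<in>I. p i * \<mu>' k i * G i (x' k)) \<longlonglongrightarrow> 0"
      using Qk by (simp add: Q_def)
  qed
  ultimately show ?thesis by blast
qed

section \<open>Random vectors with finitely many outcomes\<close>

text \<open>The events that \<open>\<xi>\<close> equals a given outcome are disjoint and exhaust the probability, so \<open>h \<circ> \<xi>\<close>
  is almost surely equal to a simple function.\<close>

lemma (in prob_space) finite_outcomes_expectation:
  fixes \<xi> :: "'a \<Rightarrow> 'b::{second_countable_topology, t2_space}" and h :: "'b \<Rightarrow> real"
  assumes [measurable]: "\<xi> \<in> borel_measurable M" "(\<lambda>\<omega>. h (\<xi> \<omega>)) \<in> borel_measurable M"
    and fin: "finite I" and inj: "inj_on out I"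
    and p: "\<And>i. i \<in> I \<Longrightarrow> prob {\<omega> \<in> space M. \<xi> \<omega> = out i} = p i" and total: "(\<Sum>i\<in>I. p i) = 1"
  shows "integrable M (\<lambda>\<omega>. h (\<xi> \<omega>))" and "expectation (\<lambda>\<omega>. h (\<xi> \<omega>)) = (\<Sum>i\<in>I. p i * h (out i))"
proof -
  let ?A = "\<lambda>i. {\<omega> \<in> space M. \<xi> \<omega> = out i}"
  have disj: "disjoint_family_on ?A I"
    using inj by (auto simp: disjoint_family_on_def dest: inj_onD)
  have "prob (\<Union>i\<in>I. ?A i) = 1"
    using fin disj p total by (subst finite_measure_finite_Union) auto
  then have ae: "AE \<omega> in M. \<omega> \<in> (\<Union>i\<in>I. ?A i)"
    by (rule prob_eq_1[THEN iffD1, rotated]) (auto intro!: sets.finite_UN fin)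
  have eq: "AE \<omega> in M. (\<Sum>i\<in>I. h (out i) * indicator (?A i) \<omega>) = h (\<xi> \<omega>)"
    using ae
  proof eventually_elim
    case (elim \<omega>)
    then obtain i where i: "i \<in> I" "\<omega> \<in> space M" "\<xi> \<omega> = out i" by auto
    have "(\<Sum>k\<in>I. h (out k) * indicator (?A k) \<omega>) = (\<Sum>k\<in>I. if k = i then h (out i) else 0)"
      using i inj by (intro sum.cong) (auto simp: indicator_def dest: inj_onD)
    then show ?case using i fin by simp
  qed
  have int: "integrable M (\<lambda>\<omega>. \<Sum>i\<in>I. h (out i) * indicator (?A i) \<omega>)"
    by (intro Bochner_Integration.integrable_sum integrable_mult_right) (auto simp: emeasure_eq_measure)
  then show "integrable M (\<lambda>\<omega>. h (\<xi> \<omega>))"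
    by (rule integrable_cong_AE_imp) (use eq in auto)
  have "expectation (\<lambda>\<omega>. h (\<xi> \<omega>)) = expectation (\<lambda>\<omega>. \<Sum>i\<in>I. h (out i) * indicator (?A i) \<omega>)"
    by (intro integral_cong_AE) (use eq in auto)
  also have "\<dots> = (\<Sum>i\<in>I. h (out i) * prob (?A i))"
    by (subst Bochner_Integration.integral_sum)
      (auto intro!: integrable_mult_right simp: emeasure_eq_measure sets.Int_space_eq2)
  finally show "expectation (\<lambda>\<omega>. h (\<xi> \<omega>)) = (\<Sum>i\<in>I. p i * h (out i))"
    using p by (simp add: mult.commute)
qed

section \<open>Subgradients of the buffered failure probability\<close>

theorem theorem2p1:
  fixes M :: "'w measure"
    and \<xi> :: "'w \<Rightarrow> real ^ 'm"
    and g :: "real ^ 'm \<Rightarrow> real ^ 'n \<Rightarrow> real"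
    and xhat y :: "real ^ 'n"
    and \<nu> :: nat
    and out :: "nat \<Rightarrow> real ^ 'm"
    and p :: "nat \<Rightarrow> real"
    and \<Gamma> :: "real set"
  assumes "prob_space M"
    and "\<xi> \<in> borel_measurable M"
    and "\<And>x. (\<lambda>\<omega>. g (\<xi> \<omega>) x) \<in> borel_measurable M"
    and "inj_on out {1..\<nu>}"
    and "\<And>i. i \<in> {1..\<nu>} \<Longrightarrow> p i > 0"
    and "\<And>i. i \<in> {1..\<nu>} \<Longrightarrow> measure M {\<omega> \<in> space M. \<xi> \<omega> = out i} = p i"
    and "(\<Sum>i=1..\<nu>. p i) = 1"
    and "\<And>i. i \<in> {1..\<nu>} \<Longrightarrow> smooth_near (g (out i)) xhat"
    and "(\<integral>\<omega>. g (\<xi> \<omega>) xhat \<partial>M) < 0"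
    and "\<exists>i\<in>{1..\<nu>}. g (out i) xhat > 0"
    and "\<Gamma> = {\<gamma>. is_arg_min (\<lambda>\<gamma>. \<integral>\<omega>. max 0 (\<gamma> * g (\<xi> \<omega>) xhat + 1) \<partial>M) (\<lambda>\<gamma>. \<gamma> \<ge> 0) \<gamma>}"
    and "y \<in> subgradients (\<lambda>x. ereal (buffered_failure_prob M (\<lambda>\<omega>. g (\<xi> \<omega>) x))) xhat"
  shows "\<exists>\<gamma>hat\<in>\<Gamma>. \<exists>\<mu> :: nat \<Rightarrow> real.
           (\<forall>i\<in>{1..\<nu>}. \<mu> i \<in> {0..1}) \<and>
           y = \<gamma>hat *\<^sub>R (\<Sum>i=1..\<nu>. (p i * \<mu> i) *\<^sub>R grad (g (out i)) xhat) \<and>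
           (\<Sum>i=1..\<nu>. p i * \<mu> i * g (out i) xhat) = 0 \<and>
           (\<forall>i\<in>{1..\<nu>}. \<mu> i \<in> (if \<gamma>hat * g (out i) xhat + 1 < 0 then {0}
                              else if \<gamma>hat * g (out i) xhat + 1 = 0 then {0..1}
                              else {1}))"
proof -
  interpret prob_space M by fact
  note [measurable] = assms(2,3)
  let ?I = "{1..\<nu>}" and ?Z = "\<lambda>x \<omega>. g (\<xi> \<omega>) x"
  let ?\<phi> = "\<lambda>x \<gamma>. \<Sum>i\<in>?I. p i * max 0 (\<gamma> * g (out i) x + 1)"
  obtain j where j: "j \<in> ?I" "0 < g (out j) xhat"
    using assms(10) by blast
  note law = finite_outcomes_expectation[OF assms(2) _ _ assms(4,6,7)]
  have int: "integrable M (?Z x)" for x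
    by (rule law(1)) auto
  have mean: "expectation (?Z x) = (\<Sum>i\<in>?I. p i * g (out i) x)" for x
    by (rule law(2)) auto
  have hinge: "hinge_mean M (?Z x) = ?\<phi> x" for x
    unfolding hinge_mean_def by (intro ext law(2)[where h = "\<lambda>e. max 0 (_ * g e x + 1)"]) auto
  have lim: "(g (out i) \<longlongrightarrow> g (out i) xhat) (nhds xhat)" if "i \<in> ?I" for i
    using smooth_near_isCont(1)[OF assms(8)[OF that]] by (simp add: isCont_def tendsto_at_iff_tendsto_nhds)
  have "((\<lambda>x. expectation (?Z x)) \<longlongrightarrow> expectation (?Z xhat)) (nhds xhat)"
    unfolding mean by (intro tendsto_intros lim; assumption)
  from order_tendstoD(2)[OF this assms(9)] order_tendstoD(1)[OF lim[OF j(1)] j(2)]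
  have "\<forall>\<^sub>F x in nhds xhat. \<exists>\<gamma>>0. is_arg_min (?\<phi> x) (\<lambda>\<gamma>. 0 \<le> \<gamma>) \<gamma> \<and>
          buffered_failure_prob M (?Z x) = ?\<phi> x \<gamma>"
  proof eventually_elim
    case (elim x)
    have "0 < p j" using assms(5) j by blast
    also have "\<dots> = prob {\<omega> \<in> space M. \<xi> \<omega> = out j}"
      using assms(6) j by simp
    also have "\<dots> \<le> failure_prob M (?Z x)"
      unfolding failure_prob_def using elim(2) by (intro finite_measure_mono) auto
    finally have fail: "failure_prob M (?Z x) \<noteq> 0" by simp
    obtain \<gamma> where \<gamma>: "is_arg_min (hinge_mean M (?Z x)) (\<lambda>\<gamma>. 0 \<le> \<gamma>) \<gamma>"
      using hinge_mean_minimizer_exists[OF int fail] by blast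
    have "0 < \<gamma>"
      using hinge_mean_minimizer_pos(1)[OF int elim(1) \<gamma>] .
    moreover have "buffered_failure_prob M (?Z x) = hinge_mean M (?Z x) \<gamma>"
      using buffered_failure_prob_eq_hinge_mean[OF int elim(1) fail \<gamma>] .
    ultimately show ?case
      using \<gamma> unfolding hinge by blast
  qed
  then have "\<exists>\<gamma> \<mu>. is_arg_min (?\<phi> xhat) (\<lambda>\<gamma>. 0 \<le> \<gamma>) \<gamma> \<and>
      (\<forall>i\<in>?I. \<mu> i \<in> hinge_subdifferential (\<gamma> * g (out i) xhat + 1)) \<and>
      y = \<gamma> *\<^sub>R (\<Sum>i\<in>?I. (p i * \<mu> i) *\<^sub>R grad (g (out i)) xhat) \<and>
      (\<Sum>i\<in>?I. p i * \<mu> i * g (out i) xhat) = 0"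
    using subgradient_hinge_multipliers[of ?I p "\<lambda>i. g (out i)" xhat j
        "\<lambda>x. buffered_failure_prob M (?Z x)" y] assms(5,8,12) j by simp
  then obtain \<gamma> \<mu> where \<gamma>: "is_arg_min (?\<phi> xhat) (\<lambda>\<gamma>. 0 \<le> \<gamma>) \<gamma>"
    and \<mu>: "\<forall>i\<in>?I. \<mu> i \<in> hinge_subdifferential (\<gamma> * g (out i) xhat + 1)"
    and eqs: "y = \<gamma> *\<^sub>R (\<Sum>i\<in>?I. (p i * \<mu> i) *\<^sub>R grad (g (out i)) xhat)"
      "(\<Sum>i\<in>?I. p i * \<mu> i * g (out i) xhat) = 0"
    by blast
  have "\<gamma> \<in> \<Gamma>"
    using \<gamma> unfolding assms(11) hinge[symmetric] hinge_mean_def by simp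
  moreover have "\<forall>i\<in>?I. \<mu> i \<in> {0..1}"
    using \<mu> by (auto simp: hinge_subdifferential_eq split: if_splits)
  ultimately show ?thesis
    using eqs \<mu> unfolding hinge_subdifferential_eq by blast
qed

end
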